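(* For every $n\in\mathbb{N}_0$ and every $k$ (a variable, or any complex number), the polynomials ${}_{T}B_{n}^{(c,v)}(x,y,z;\lambda)$ satisfy the implicit summation formula $${}_{T}B_{n}^{(c,v)}(x+k,y,z;\lambda)=\sum_{r=0}^n\binom{n}{r}\,{}_{T}B_{n-r}^{(c,v)}(x,y,z;\lambda)\,k^{r}.$$
   Context: $\mathbb{N}_0=\{0,1,2,\dots\}$; $x,y,z$ are variables (taking complex values) and $\lambda\in\mathbb{C}\setminus\{0\}$. Let $\mathcal{U}(y,t)=\sum_{n\ge0}\mathcal{U}_n(y)\frac{t^n}{n!}$ be a power series in $t$ with coefficients depending on $y$ and $\mathcal{U}_0(y)\neq0$; the 2-variable general polynomials $T_n(x,y)$ are defined by $e^{xt}\mathcal{U}(y,t)=\sum_{n\ge0}T_n(x,y)\frac{t^n}{n!}$, with the normalization $T_0(x,y)=1$. The order $v$ is such that $\bigl(\frac{t}{\lambda e^t-1}\bigr)^v$ is a power series in $t$ ($v\in\mathbb{N}_0$ in general; $v\in\mathbb{C}$ allowed when $\lambda=1$, with the branch $1^v=1$ at $t=0$). The cosine parametric kind of generalized Apostol--Bernoulli polynomials is defined, as power series in $t$, by $$\Bigl(\frac{t}{\lambda e^t-1}\Bigr)^v e^{xt}\,\mathcal{U}(y,t)\cos(zt)=\sum_{n=0}^\infty {}_{T}B_{n}^{(c,v)}(x,y,z;\lambda)\frac{t^n}{n!}.$$ The convention $k^0=1$ is used. *)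

theory Defs
  imports "HOL-Computational_Algebra.Formal_Power_Series"
begin

definition egf :: "(nat \<Rightarrow> complex) \<Rightarrow> complex fps" where
  "egf a = Abs_fps (\<lambda>n. a n / fact n)"

definition egf_coeff :: "complex fps \<Rightarrow> nat \<Rightarrow> complex" where
  "egf_coeff F n = fact n * fps_nth F n"

lemma egf_egf_coeff [simp]: "egf (egf_coeff F) = F"
  by (simp add: egf_def egf_coeff_def fps_eq_iff)

lemma egf_eq_iff: "egf a = F \<longleftrightarrow> a = egf_coeff F"
  by (auto simp: egf_def egf_coeff_def fps_eq_iff fun_eq_iff field_simps)

text \<open>
  The two-variable general polynomials attached to the sequence of coefficient functions
  \<open>U n y\<close>; here \<open>egf (\<lambda>n. U n y)\<close> is the series \<open>\<U>(y, t)\<close> in \<open>t\<close>.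
\<close>

definition gen_poly :: "(nat \<Rightarrow> complex \<Rightarrow> complex) \<Rightarrow> nat \<Rightarrow> complex \<Rightarrow> complex \<Rightarrow> complex" where
  "gen_poly U n x y = egf_coeff (fps_exp x * egf (\<lambda>m. U m y)) n"

lemma gen_poly_egf: "fps_exp x * egf (\<lambda>m. U m y) = egf (\<lambda>n. gen_poly U n x y)"
  by (simp add: gen_poly_def)

text \<open>
  A power of a formal power series with a complex exponent: the usual power if the exponent is a
  natural number, and otherwise the binomial series \<open>\<Sum>k. (v gchoose k) * (F - 1) ^ k\<close>, which is
  meaningful when the constant term of \<open>F\<close> is \<open>1\<close> and picks the branch \<open>1\<^sup>v = 1\<close>.
  On the common domain the two clauses agree.
\<close>

definition fps_cpower :: "complex fps \<Rightarrow> complex \<Rightarrow> complex fps" where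
  "fps_cpower F v =
     (if v \<in> \<nat> then F ^ (THE n. v = of_nat n) else fps_binomial v oo (F - 1))"

lemma fps_cpower_of_nat [simp]: "fps_cpower F (of_nat n) = F ^ n"
  by (simp add: fps_cpower_def)

lemma fps_cpower_eq_binomial:
  assumes "fps_nth F 0 = 1"
  shows "fps_cpower F v = fps_binomial v oo (F - 1)"
proof (cases "v \<in> \<nat>")
  case True
  then obtain n where "v = of_nat n"
    by (auto elim: Nats_cases)
  with assms show ?thesis
    by (simp add: fps_binomial_of_nat fps_compose_power [symmetric] fps_compose_add_distrib)
qed (simp add: fps_cpower_def)

text \<open>
  For \<open>lam = 1\<close> the denominator has order of vanishing one and the division below is the exact one,
  with constant term \<open>1\<close>; for \<open>lam \<noteq> 1\<close> the denominator is a unit.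
\<close>

definition apostol_base :: "complex \<Rightarrow> complex fps" where
  "apostol_base lam = fps_X / (fps_const lam * fps_exp 1 - 1)"

lemma apostol_base_mult: "apostol_base lam * (fps_const lam * fps_exp 1 - 1) = fps_X"
proof -
  define D :: "complex fps" where "D = fps_const lam * fps_exp 1 - 1"
  have nz: "fps_nth D 0 \<noteq> 0 \<or> fps_nth D 1 \<noteq> 0"
    by (auto simp: D_def)
  then have "D \<noteq> 0"
    by auto
  moreover have "subdegree D \<le> 1"
    using nz by (metis subdegree_leI le_numeral_extra(3) le0 order_trans)
  ultimately have "D dvd fps_X"
    by (simp add: fps_dvd_iff)
  then show ?thesis
    by (simp add: apostol_base_def D_def)
qed

lemma apostol_base_1_nth_0: "fps_nth (apostol_base 1) 0 = 1"
proof -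
  have "fps_nth (apostol_base 1 * (fps_const 1 * fps_exp 1 - 1)) 1 = fps_nth fps_X 1"
    by (simp only: apostol_base_mult)
  then show ?thesis
    by (simp add: fps_mult_nth)
qed

text \<open>
  The cosine parametric generalized Apostol-Bernoulli polynomials of order \<open>v\<close>. The definition is
  intended for \<open>v \<in> \<nat>\<close>, or \<open>lam = 1\<close> and arbitrary complex \<open>v\<close>.
\<close>

definition cos_apostol_bernoulli ::
    "(nat \<Rightarrow> complex \<Rightarrow> complex) \<Rightarrow> complex \<Rightarrow> nat \<Rightarrow> complex \<Rightarrow> complex \<Rightarrow> complex \<Rightarrow> complex \<Rightarrow> complex"
  where
  "cos_apostol_bernoulli U v n x y z lam =
     egf_coeff (fps_cpower (apostol_base lam) v * fps_exp x * egf (\<lambda>m. U m y) * fps_cos z) n"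

lemma cos_apostol_bernoulli_egf:
  "fps_cpower (apostol_base lam) v * fps_exp x * egf (\<lambda>m. U m y) * fps_cos z =
     egf (\<lambda>n. cos_apostol_bernoulli U v n x y z lam)"
  by (simp add: cos_apostol_bernoulli_def)

end

theory Submission
  imports Defs
begin

text \<open>Since e^((x+k)t) = e^(xt) e^(kt), shifting x by k multiplies the generating function by
  e^(kt), whatever the other factors are. On exponential generating functions this multiplication is
  binomial convolution with the powers of k, as \<open>egf_coeff_mult_fps_exp\<close>
  states.\<close>

lemma egf_coeff_mult_fps_exp:
  "egf_coeff (F * fps_exp k) n = (\<Sum>r = 0..n. of_nat (n choose r) * egf_coeff F (n - r) * k ^ r)"
proof -
  have "egf_coeff (F * fps_exp k) n = (\<Sum>r = 0..n. fact n * (k ^ r / fact r * fps_nth F (n - r)))"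
    \<comment> \<open>Commuting puts the exponential first, so the Cauchy product index r falls on
      \<open>k ^ r\<close>.\<close>
    by (simp add: egf_coeff_def mult.commute [of F] fps_mult_nth sum_distrib_left)
  also have "\<dots> = (\<Sum>r = 0..n. of_nat (n choose r) * egf_coeff F (n - r) * k ^ r)"
    \<comment> \<open>The \<open>fact (n - r)\<close> hidden in \<open>egf_coeff F (n - r)\<close>
      cancels against the binomial coefficient, leaving \<open>fact n / fact r\<close>; the index
      range gives r \<le> n.\<close>
    by (intro sum.cong refl) (simp add: egf_coeff_def binomial_fact)
  finally show ?thesis .
qed

theorem theorem3p3:
  fixes U :: "nat \<Rightarrow> complex \<Rightarrow> complex"
    and lam v x y z k :: complex
    and n :: nat
  assumes "lam \<noteq> 0"
    and "v \<in> \<nat> \<or> lam = 1"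
    and "\<And>y. U 0 y \<noteq> 0"
    and "\<And>x y. gen_poly U 0 x y = 1"
  shows "cos_apostol_bernoulli U v n (x + k) y z lam =
    (\<Sum>r = 0..n. of_nat (n choose r) * cos_apostol_bernoulli U v (n - r) x y z lam * k ^ r)"
proof -
  have "cos_apostol_bernoulli U v n (x + k) y z lam =
      egf_coeff (fps_cpower (apostol_base lam) v * fps_exp x * egf (\<lambda>m. U m y) * fps_cos z * fps_exp k) n"
    by (simp add: cos_apostol_bernoulli_def fps_exp_add_mult mult_ac)
  then show ?thesis
    by (simp only: egf_coeff_mult_fps_exp cos_apostol_bernoulli_def)
qed

end
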